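(* Let $n_1,n_2,n_3\in\mathbb{N}_0$, let $\alpha,\beta,\gamma,\delta$ be real parameters, and put $n=n_1+n_2+n_3$, $w=1-x-y-z$. The polynomials $P_{n_1,n_2,n_3}^{(\alpha,\beta,\gamma,\delta)}$ defined in the context satisfy the following four relations (all polynomials evaluated at $(x,y,z)$). (1) $$(2n+\alpha+\beta+\gamma+\delta+3)\,x\,P_{n_1,n_2,n_3}^{(\alpha,\beta,\gamma,\delta)}=(n_1+\alpha)P_{n_1,n_2,n_3}^{(\alpha-1,\beta,\gamma,\delta)}+(n_1+1)P_{n_1+1,n_2,n_3}^{(\alpha-1,\beta,\gamma,\delta)};$$ (2) $$\begin{aligned}&(2n+\alpha+\beta+\gamma+\delta+3)(2n_2+2n_3+\beta+\gamma+\delta+2)\,y\,P_{n_1,n_2,n_3}^{(\alpha,\beta,\gamma,\delta)}\\&=(n+n_2+n_3+\beta+\gamma+\delta+2)(n_2+\beta)P_{n_1,n_2,n_3}^{(\alpha,\beta-1,\gamma,\delta)}\\&\quad+(n+n_2+n_3+\alpha+\beta+\gamma+\delta+3)(n_2+1)P_{n_1,n_2+1,n_3}^{(\alpha,\beta-1,\gamma,\delta)}\\&\quad-(n_1+1)(n_2+\beta)P_{n_1+1,n_2,n_3}^{(\alpha,\beta-1,\gamma,\delta)}-(n_1+\alpha)(n_2+1)P_{n_1-1,n_2+1,n_3}^{(\alpha,\beta-1,\gamma,\delta)};\end{aligned}$$ (3) $$\begin{aligned}&(2n+\alpha+\beta+\gamma+\delta+3)(2n_2+2n_3+\beta+\g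amma+\delta+2)(\gamma+\delta+2n_3+1)\,z\,P_{n_1,n_2,n_3}^{(\alpha,\beta,\gamma,\delta)}\\&=(n+n_2+n_3+\beta+\gamma+\delta+2)(n_2+2n_3+\gamma+\delta+1)(n_3+\gamma)P_{n_1,n_2,n_3}^{(\alpha,\beta,\gamma-1,\delta)}\\&\quad-(n_1+1)(n_2+2n_3+\gamma+\delta+1)(n_3+\gamma)P_{n_1+1,n_2,n_3}^{(\alpha,\beta,\gamma-1,\delta)}\\&\quad-(n+n_2+n_3+\alpha+\beta+\gamma+\delta+3)(n_2+1)(n_3+\gamma)P_{n_1,n_2+1,n_3}^{(\alpha,\beta,\gamma-1,\delta)}\\&\quad+(n_1+\alpha)(n_2+1)(n_3+\gamma)P_{n_1-1,n_2+1,n_3}^{(\alpha,\beta,\gamma-1,\delta)}\\&\quad+(n+n_2+n_3+\alpha+\beta+\gamma+\delta+3)(n_2+2n_3+\beta+\gamma+\delta+2)(n_3+1)P_{n_1,n_2,n_3+1}^{(\alpha,\beta,\gamma-1,\delta)}\\&\quad-(n_1+\alpha)(n_2+2n_3+\beta+\gamma+\delta+2)(n_3+1)P_{n_1-1,n_2,n_3+1}^{(\alpha,\beta,\gamma-1,\delta)}\\&\quad-(n+n_2+n_3+\beta+\gamma+\delta+2)(n_2+\beta)(n_3+1)P_{n_1,n_2-1,n_3+1}^{(\alpha,\beta,\gamma-1,\delta)}\\&\quad+(n_1+1)(n_2+\beta)(n_3+1)P_{n_1+1,n_2-1,n_3+1}^{(\alpha,\beta,\gamma-1,\delta)};\end{aligned}$$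 (4) $$\begin{aligned}&(2n+\alpha+\beta+\gamma+\delta+3)(2n_2+2n_3+\beta+\gamma+\delta+2)(\gamma+\delta+2n_3+1)\,w\,P_{n_1,n_2,n_3}^{(\alpha,\beta,\gamma,\delta)}\\&=-(n+n_2+n_3+\alpha+\beta+\gamma+\delta+3)(n_2+2n_3+\beta+\gamma+\delta+2)(n_3+1)P_{n_1,n_2,n_3+1}^{(\alpha,\beta,\gamma,\delta-1)}\\&\quad+(n_1+\alpha)(n_2+2n_3+\beta+\gamma+\delta+2)(n_3+1)P_{n_1-1,n_2,n_3+1}^{(\alpha,\beta,\gamma,\delta-1)}\\&\quad+(n+n_2+n_3+\beta+\gamma+\delta+2)(n_2+\beta)(n_3+1)P_{n_1,n_2-1,n_3+1}^{(\alpha,\beta,\gamma,\delta-1)}\\&\quad-(n_1+1)(n_2+\beta)(n_3+1)P_{n_1+1,n_2-1,n_3+1}^{(\alpha,\beta,\gamma,\delta-1)}\\&\quad+(n+n_2+n_3+\beta+\gamma+\delta+2)(n_2+2n_3+\gamma+\delta+1)(n_3+\delta)P_{n_1,n_2,n_3}^{(\alpha,\beta,\gamma,\delta-1)}\\&\quad-(n_1+1)(n_2+2n_3+\gamma+\delta+1)(n_3+\delta)P_{n_1+1,n_2,n_3}^{(\alpha,\beta,\gamma,\delta-1)}\\&\quad-(n+n_2+n_3+\alpha+\beta+\gamma+\delta+3)(n_2+1)(n_3+\delta)P_{n_1,n_2+1,n_3}^{(\alpha,\beta,\gamma,\delta-1)}\\&\quad+(n_1+\alpha)(n_2+1)(n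_3+\delta)P_{n_1-1,n_2+1,n_3}^{(\alpha,\beta,\gamma,\delta-1)}.\end{aligned}$$
   Context: Jacobi polynomials: for $n\in\mathbb{N}_0=\{0,1,2,\dots\}$ and real $p,q$, $$P_n^{(p,q)}(t)=\frac{(-1)^n}{2^n n!}(1-t)^{-p}(1+t)^{-q}\frac{d^n}{dt^n}\left\{(1-t)^{n+p}(1+t)^{n+q}\right\}$$ (a polynomial in $t$). Points $(x,y,z)$ range over the simplex $\mathbb{T}^3=\{(x,y,z)\in\mathbb{R}^3: x,y,z>0,\ 1-x-y-z>0\}$. Koornwinder polynomials in three variables on the simplex: for $n_1,n_2,n_3\in\mathbb{N}_0$, $$P_{n_1,n_2,n_3}^{(\alpha,\beta,\gamma,\delta)}(x,y,z)=P_{n_1}^{(\beta+\gamma+\delta+2n_2+2n_3+2,\,\alpha)}(2x-1)\,(1-x)^{n_2}\,P_{n_2}^{(\gamma+\delta+2n_3+1,\,\beta)}\!\left(\tfrac{2y}{1-x}-1\right)(1-x-y)^{n_3}\,P_{n_3}^{(\delta,\gamma)}\!\left(\tfrac{2z}{1-x-y}-1\right).$$ A polynomial with a negative index is zero by convention. *)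

theory Defs
  imports "HOL-Analysis.Analysis"
begin

definition simplex3 :: "(real \<times> real \<times> real) set" where
  "simplex3 = {(x, y, z). x > 0 \<and> y > 0 \<and> z > 0 \<and> 1 - x - y - z > 0}"

text \<open>
  Rodrigues' formula. Since real powers are meaningful only for positive bases, \<open>jacobi n p q t\<close>
  is the value of the Jacobi polynomial only for \<open>-1 < t < 1\<close>. All arguments that occur in
  \<open>koornwinder\<close> below lie in this interval when \<open>(x, y, z) \<in> simplex3\<close>.
\<close>

definition jacobi :: "nat \<Rightarrow> real \<Rightarrow> real \<Rightarrow> real \<Rightarrow> real" where
  "jacobi n p q t =
     (- 1) ^ n / (2 ^ n * fact n) * (1 - t) powr (- p) * (1 + t) powr (- q) *
     (deriv ^^ n) (\<lambda>s. (1 - s) powr (real n + p) * (1 + s) powr (real n + q)) t"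

definition koornwinder_nat ::
  "real \<Rightarrow> real \<Rightarrow> real \<Rightarrow> real \<Rightarrow> nat \<Rightarrow> nat \<Rightarrow> nat \<Rightarrow> real \<times> real \<times> real \<Rightarrow> real" where
  "koornwinder_nat \<alpha> \<beta> \<gamma> \<delta> n1 n2 n3 = (\<lambda>(x, y, z).
     jacobi n1 (\<beta> + \<gamma> + \<delta> + 2 * real n2 + 2 * real n3 + 2) \<alpha> (2 * x - 1) *
     (1 - x) ^ n2 *
     jacobi n2 (\<gamma> + \<delta> + 2 * real n3 + 1) \<beta> (2 * y / (1 - x) - 1) *
     (1 - x - y) ^ n3 *
     jacobi n3 \<delta> \<gamma> (2 * z / (1 - x - y) - 1))"

text \<open>Indices are integers so that a polynomial with a negative index is zero.\<close>

definition koornwinder ::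
  "real \<Rightarrow> real \<Rightarrow> real \<Rightarrow> real \<Rightarrow> int \<Rightarrow> int \<Rightarrow> int \<Rightarrow> real \<times> real \<times> real \<Rightarrow> real" where
  "koornwinder \<alpha> \<beta> \<gamma> \<delta> k1 k2 k3 v =
     (if k1 < 0 \<or> k2 < 0 \<or> k3 < 0 then 0
      else koornwinder_nat \<alpha> \<beta> \<gamma> \<delta> (nat k1) (nat k2) (nat k3) v)"

end

theory Submission
  imports Defs
begin

text \<open>
  A Koornwinder polynomial is a product of three univariate Jacobi polynomials, each
  homogenised with respect to its own denominator. With \<open>c\<^sub>1 = 1\<close>, \<open>c\<^sub>2 = c\<^sub>1 - x\<close> and
  \<open>c\<^sub>3 = c\<^sub>2 - y\<close> the factors are \<open>c\<^sub>1 ^ n\<^sub>1 P\<^bsub>n\<^sub>1\<^esub>(2x/c\<^sub>1 - 1)\<close>, \<open>c\<^sub>2 ^ n\<^sub>2 P\<^bsub>n\<^sub>2\<^esub>(2y/c\<^sub>2 - 1)\<close> and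
  \<open>c\<^sub>3 ^ n\<^sub>3 P\<^bsub>n\<^sub>3\<^esub>(2z/c\<^sub>3 - 1)\<close>, and \<open>w = c\<^sub>3 - z\<close>. All four relations follow from
  three contiguous relations for a single homogenised factor with denominator \<open>c\<close> and
  variable \<open>y\<close>: one absorbs a factor \<open>y\<close> and lowers \<open>q\<close>, one absorbs \<open>c - y\<close> and lowers \<open>p\<close>,
  and one raises \<open>p\<close>.

  Multiplying by \<open>z\<close>, say, lowers a parameter of the third factor, at the price of a factor
  \<open>c\<^sub>3\<close> in the term whose degree stays the same. The first parameter of the second factor
  depends on \<open>n\<^sub>3\<close> and on the lowered parameter: it goes down by one in the
  term with the factor \<open>c\<^sub>3 = c\<^sub>2 - y\<close>, and up by one in the term of degree \<open>n\<^sub>3 + 1\<close>. These are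
  just the two changes that the second and third relations effect. They in turn leave behind the
  factor \<open>c\<^sub>2 = c\<^sub>1 - x\<close> exactly where the first factor needs its parameter lowered. Hence
  each multiplication passes through the factors, the number of terms doubling each time:
  two, four or eight.

  By Rodrigues' formula the three contiguous relations all come from one identity between
  derivatives and its mirror image under \<open>s \<mapsto> -s\<close> (\<open>weight_deriv_contiguous\<close>), which combines
  the derivative of \<open>(1 - s)\<^sup>a (1 + s)\<^sup>b\<close> with \<open>(1 - s) + (1 + s) = 2\<close>. The relation
  that raises \<open>p\<close> needs Leibniz' rule in addition (\<open>weight_deriv_leibniz\<close>).
\<close>

section \<open>Derivatives of the Jacobi weight\<close>

text \<open>
  The \<open>n\<close>-th derivative of \<open>(1 - s)\<^sup>a (1 + s)\<^sup>b\<close> for \<open>-1 < s < 1\<close>. The recursion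
  differentiates first and lets the exponents vary, so that identities between these derivatives
  become plain inductions over \<open>n\<close> at a fixed point, without further calculus.
\<close>

primrec weight_deriv :: "nat \<Rightarrow> real \<Rightarrow> real \<Rightarrow> real \<Rightarrow> real" where
  "weight_deriv 0 a b s = (1 - s) powr a * (1 + s) powr b"
| "weight_deriv (Suc n) a b s = b * weight_deriv n a (b - 1) s - a * weight_deriv n (a - 1) b s"

lemma has_derivative_weight_deriv:
  assumes "-1 < s" "s < 1"
  shows "(weight_deriv n a b has_real_derivative weight_deriv (Suc n) a b s) (at s)"
proof (induction n arbitrary: a b)
  case 0
  have "((\<lambda>s. (1 - s) powr a * (1 + s) powr b) has_real_derivative weight_deriv (Suc 0) a b s) (at s)"
    using assms by (auto intro!: derivative_eq_intros simp: algebra_simps)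
  moreover have "weight_deriv 0 a b = (\<lambda>s. (1 - s) powr a * (1 + s) powr b)"
    by (rule ext) simp
  ultimately show ?case by metis
next
  case (Suc n)
  have "((\<lambda>s. b * weight_deriv n a (b - 1) s - a * weight_deriv n (a - 1) b s)
      has_real_derivative weight_deriv (Suc (Suc n)) a b s) (at s)"
    by (subst weight_deriv.simps(2), intro DERIV_diff DERIV_cmult Suc.IH)
  moreover have "weight_deriv (Suc n) a b
      = (\<lambda>s. b * weight_deriv n a (b - 1) s - a * weight_deriv n (a - 1) b s)"
    by (rule ext) simp
  ultimately show ?case by metis
qed

lemma higher_deriv_weight:
  assumes "-1 < t" "t < 1"
  shows "(deriv ^^ n) (\<lambda>s. (1 - s) powr a * (1 + s) powr b) t = weight_deriv n a b t"
  using assms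
proof (induction n arbitrary: t)
  case 0
  then show ?case by simp
next
  case (Suc n)
  have "((deriv ^^ n) (\<lambda>s. (1 - s) powr a * (1 + s) powr b)
      has_real_derivative weight_deriv (Suc n) a b t) (at t)"
    by (rule has_field_derivative_transform_within_open
          [OF has_derivative_weight_deriv[OF Suc.prems], where S = "{-1<..<1}"])
      (use Suc in auto)
  then show ?case by (simp add: DERIV_imp_deriv del: weight_deriv.simps)
qed

lemma weight_deriv_split:
  assumes "-1 < t" "t < 1"
  shows "weight_deriv n (a + 1) b t + weight_deriv n a (b + 1) t = 2 * weight_deriv n a b t"
proof (induction n arbitrary: a b)
  case 0
  have pw: "(1 - t) powr (a + 1) = (1 - t) * (1 - t) powr a"
    "(1 + t) powr (b + 1) = (1 + t) * (1 + t) powr b"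
    using assms by (simp_all add: powr_add)
  show ?case
    unfolding weight_deriv.simps pw by (simp add: algebra_simps)
next
  case (Suc n)
  from Suc.IH[of a "b - 1"] Suc.IH[of "a - 1" b] show ?case
    by (simp add: algebra_simps) algebra
qed

text \<open>
  Leibniz' rule for the product of \<open>1 - s\<close> with the weight, whose sum has only two terms.
\<close>

lemma weight_deriv_leibniz:
  assumes "-1 < t" "t < 1"
  shows "weight_deriv (Suc n) (a + 1) b t
    = (1 - t) * weight_deriv (Suc n) a b t - real (Suc n) * weight_deriv n a b t"
proof (induction n arbitrary: a b)
  case 0
  have pw: "(1 - t) powr (a + 1) = (1 - t) * (1 - t) powr a"
    "(1 - t) powr a = (1 - t) * (1 - t) powr (a - 1)"
    using assms by (simp_all add: powr_add powr_diff)
  show ?case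
    unfolding weight_deriv.simps add_diff_cancel_right' pw by (simp add: algebra_simps)
next
  case (Suc n)
  have "weight_deriv (Suc (Suc n)) (a + 1) b t
      = b * weight_deriv (Suc n) (a + 1) (b - 1) t - (a + 1) * weight_deriv (Suc n) a b t"
    by (subst weight_deriv.simps(2)) simp
  also have "\<dots> = (1 - t) * weight_deriv (Suc (Suc n)) a b t
      - real (Suc (Suc n)) * weight_deriv (Suc n) a b t"
  proof -
    define X where "X = weight_deriv (Suc n) a (b - 1) t"
    define Y where "Y = weight_deriv (Suc n) (a - 1) b t"
    define U where "U = weight_deriv n a (b - 1) t"
    define V where "V = weight_deriv n (a - 1) b t"
    have "weight_deriv (Suc n) (a + 1) (b - 1) t = (1 - t) * X - real (Suc n) * U"
      using Suc.IH[of a "b - 1"] by (simp only: X_def U_def)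
    moreover have "weight_deriv (Suc n) a b t = (1 - t) * Y - real (Suc n) * V"
      using Suc.IH[of "a - 1" b] by (simp only: Y_def V_def diff_add_cancel)
    moreover have "weight_deriv (Suc n) a b t = b * U - a * V"
      by (simp add: U_def V_def)
    moreover have "weight_deriv (Suc (Suc n)) a b t = b * X - a * Y"
      unfolding X_def Y_def by (rule weight_deriv.simps(2))
    ultimately show ?thesis
      by (simp only: of_nat_Suc) algebra
  qed
  finally show ?case .
qed

text \<open>
  Both forms come from differentiating the weight once and then replacing \<open>1 \<mp> s\<close> by
  \<open>2 - (1 \<plusminus> s)\<close>.
\<close>

lemma weight_deriv_contiguous:
  assumes "-1 < t" "t < 1"
  shows "(a + b + 1) * weight_deriv n a b t
      = 2 * b * weight_deriv n a (b - 1) t - weight_deriv (Suc n) (a + 1) b t"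
    and "(a + b + 1) * weight_deriv n a b t
      = 2 * a * weight_deriv n (a - 1) b t + weight_deriv (Suc n) a (b + 1) t"
proof -
  have split: "weight_deriv n (a + 1) (b - 1) t = 2 * weight_deriv n a (b - 1) t - weight_deriv n a b t"
    using weight_deriv_split[OF assms, of n a "b - 1"] by simp
  show "(a + b + 1) * weight_deriv n a b t
      = 2 * b * weight_deriv n a (b - 1) t - weight_deriv (Suc n) (a + 1) b t"
    unfolding weight_deriv.simps(2) add_diff_cancel_right' split
    by (simp add: algebra_simps)
  have split': "weight_deriv n (a - 1) (b + 1) t = 2 * weight_deriv n (a - 1) b t - weight_deriv n a b t"
    using weight_deriv_split[OF assms, of n "a - 1" b] by simp
  show "(a + b + 1) * weight_deriv n a b t
      = 2 * a * weight_deriv n (a - 1) b t + weight_deriv (Suc n) a (b + 1) t"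
    unfolding weight_deriv.simps(2) add_diff_cancel_right' split'
    by (simp add: algebra_simps)
qed

section \<open>Contiguous relations for Jacobi polynomials\<close>

lemma jacobi_eq_weight_deriv:
  assumes "-1 < t" "t < 1"
  shows "jacobi n p q t = (- 1) ^ n / (2 ^ n * fact n) * (1 - t) powr (- p) * (1 + t) powr (- q) *
    weight_deriv n (real n + p) (real n + q) t"
  unfolding jacobi_def higher_deriv_weight[OF assms] ..

lemma jacobi_0:
  assumes "-1 < t" "t < 1"
  shows "jacobi 0 p q t = 1"
  using assms by (simp add: jacobi_def powr_minus field_simps)

lemma rodrigues_constant_Suc:
  "(- 1) ^ n / (2 ^ n * fact n)
    = - 2 * (real n + 1) * ((- 1) ^ Suc n / (2 ^ Suc n * fact (Suc n)))"
proof -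
  have "real n + 1 \<noteq> 0" by linarith
  then show ?thesis by (simp add: divide_simps) (simp add: algebra_simps)
qed

text \<open>
  Rodrigues' formula turns the following relations into statements about derivatives of the
  weight. With \<open>a = n + p\<close> and \<open>b = n + q\<close> the two that lower a parameter are the two forms of
  \<open>weight_deriv_contiguous\<close>. The term of degree \<open>n + 1\<close> fits because raising the degree raises
  both exponents, and lowering \<open>q\<close> or \<open>p\<close> restores \<open>b\<close> or \<open>a\<close>, respectively.
\<close>

lemma jacobi_lower_q:
  assumes "-1 < t" "t < 1"
  shows "(2 * real n + p + q + 1) * ((1 + t) / 2) * jacobi n p q t
    = (real n + q) * jacobi n p (q - 1) t + (real n + 1) * jacobi (Suc n) p (q - 1) t"
proof -
  define a b where "a = real n + p" and "b = real n + q"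
  define C where "C = (- 1) ^ n / (2 ^ n * fact n) * (1 - t) powr (- p) * (1 + t) powr (- q)"
  have pw: "(1 + t) powr (- (q - 1)) = (1 + t) * (1 + t) powr (- q)"
    using assms by (simp add: powr_diff powr_minus field_simps)
  have "jacobi n p q t = C * weight_deriv n a b t"
    using jacobi_eq_weight_deriv[OF assms, of n p q] by (simp add: C_def a_def b_def)
  moreover have "jacobi n p (q - 1) t = C * (1 + t) * weight_deriv n a (b - 1) t"
    unfolding jacobi_eq_weight_deriv[OF assms] pw by (simp add: C_def a_def b_def add_diff_eq)
  moreover have "(real n + 1) * jacobi (Suc n) p (q - 1) t
      = - C * (1 + t) / 2 * weight_deriv (Suc n) (a + 1) b t"
  proof -
    have exps: "real (Suc n) + p = a + 1" "real (Suc n) + (q - 1) = b"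
      by (simp_all add: a_def b_def)
    show ?thesis
      unfolding jacobi_eq_weight_deriv[OF assms] pw exps C_def rodrigues_constant_Suc[of n]
      by (simp add: field_simps del: weight_deriv.simps power_Suc fact_Suc)
  qed
  moreover have "2 * real n + p + q + 1 = a + b + 1" "real n + q = b"
    by (simp_all add: a_def b_def)
  ultimately show ?thesis
    using weight_deriv_contiguous(1)[OF assms, of a b n]
    by (simp only:) algebra
qed

lemma jacobi_lower_p:
  assumes "-1 < t" "t < 1"
  shows "(2 * real n + p + q + 1) * ((1 - t) / 2) * jacobi n p q t
    = (real n + p) * jacobi n (p - 1) q t - (real n + 1) * jacobi (Suc n) (p - 1) q t"
proof -
  define a b where "a = real n + p" and "b = real n + q"
  define C where "C = (- 1) ^ n / (2 ^ n * fact n) * (1 - t) powr (- p) * (1 + t) powr (- q)"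
  have pw: "(1 - t) powr (- (p - 1)) = (1 - t) * (1 - t) powr (- p)"
    using assms by (simp add: powr_diff powr_minus field_simps)
  have "jacobi n p q t = C * weight_deriv n a b t"
    using jacobi_eq_weight_deriv[OF assms, of n p q] by (simp add: C_def a_def b_def)
  moreover have "jacobi n (p - 1) q t = C * (1 - t) * weight_deriv n (a - 1) b t"
    unfolding jacobi_eq_weight_deriv[OF assms] pw by (simp add: C_def a_def b_def add_diff_eq)
  moreover have "(real n + 1) * jacobi (Suc n) (p - 1) q t
      = - C * (1 - t) / 2 * weight_deriv (Suc n) a (b + 1) t"
  proof -
    have exps: "real (Suc n) + (p - 1) = a" "real (Suc n) + q = b + 1"
      by (simp_all add: a_def b_def)
    show ?thesis
      unfolding jacobi_eq_weight_deriv[OF assms] pw exps C_def rodrigues_constant_Suc[of n]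
      by (simp add: field_simps del: weight_deriv.simps power_Suc fact_Suc)
  qed
  moreover have "2 * real n + p + q + 1 = a + b + 1" "real n + p = a"
    by (simp_all add: a_def b_def)
  ultimately show ?thesis
    using weight_deriv_contiguous(2)[OF assms, of a b n]
    by (simp only:) algebra
qed

text \<open>
  Compared with the weight for \<open>p + 1\<close>, the left-hand side carries an additional factor \<open>1 - t\<close>.
  Leibniz' rule moves it inside the derivative, and what is left over is
  \<open>weight_deriv_contiguous\<close> for the derivative of order one less.
\<close>

lemma jacobi_raise_p:
  assumes "-1 < t" "t < 1"
  shows "(2 * real (Suc n) + p + q + 1) * jacobi (Suc n) p q t
    = (real (Suc n) + p + q + 1) * jacobi (Suc n) (p + 1) q t
      - (real (Suc n) + q) * jacobi n (p + 1) q t"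
proof -
  define m where "m = real (Suc n)"
  define a b where "a = m + p" and "b = m + q"
  define C where
    "C = (- 1) ^ Suc n / (2 ^ Suc n * fact (Suc n)) * (1 - t) powr (- (p + 1)) * (1 + t) powr (- q)"
  have pw: "(1 - t) powr (- p) = (1 - t) * (1 - t) powr (- (p + 1))"
    using assms by (simp add: powr_diff powr_minus field_simps)
  have "jacobi (Suc n) p q t = C * (1 - t) * weight_deriv (Suc n) a b t"
    unfolding jacobi_eq_weight_deriv[OF assms] pw
    by (simp add: C_def a_def b_def m_def del: weight_deriv.simps)
  moreover have "jacobi (Suc n) (p + 1) q t = C * weight_deriv (Suc n) (a + 1) b t"
    unfolding jacobi_eq_weight_deriv[OF assms]
    by (simp add: C_def a_def b_def m_def add_ac del: weight_deriv.simps)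
  moreover have "jacobi n (p + 1) q t = - C * 2 * m * weight_deriv n a (b - 1) t"
  proof -
    have exps: "real n + (p + 1) = a" "real n + q = b - 1"
      by (simp_all add: a_def b_def m_def)
    show ?thesis
      unfolding jacobi_eq_weight_deriv[OF assms] exps C_def m_def rodrigues_constant_Suc[of n]
      by (simp add: field_simps del: weight_deriv.simps power_Suc fact_Suc)
  qed
  moreover have "2 * real (Suc n) + p + q + 1 = a + b + 1" "real (Suc n) + q = b"
    "real (Suc n) + p + q + 1 = a + b + 1 - m"
    by (simp_all add: a_def b_def m_def)
  moreover have "weight_deriv (Suc n) (a + 1) b t
      = (1 - t) * weight_deriv (Suc n) a b t - m * weight_deriv n a b t"
    unfolding m_def by (rule weight_deriv_leibniz[OF assms])
  ultimately show ?thesis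
    using weight_deriv_contiguous(1)[OF assms, of a b n]
    by (simp only:) algebra
qed

section \<open>Homogenised Jacobi polynomials\<close>

text \<open>
  The homogeneous form of degree \<open>k\<close> in \<open>(c, y)\<close> whose value at \<open>c = 1\<close> is the Jacobi polynomial
  shifted to the unit interval. Putting the power of \<open>c\<close> into the definition makes the powers
  in a Koornwinder polynomial disappear, and an integer degree covers the
  boundary cases in which a lowered degree becomes negative.
\<close>

definition hom_jacobi :: "int \<Rightarrow> real \<Rightarrow> real \<Rightarrow> real \<Rightarrow> real \<Rightarrow> real" where
  "hom_jacobi k p q c y = (if k < 0 then 0 else c ^ nat k * jacobi (nat k) p q (2 * y / c - 1))"

lemma hom_jacobi_lower_q:
  assumes "0 < y" "y < c"
  shows "(2 * real n + p + q + 1) * (y * hom_jacobi (int n) p q c y)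
    = (real n + q) * (c * hom_jacobi (int n) p (q - 1) c y)
      + (real n + 1) * hom_jacobi (int n + 1) p (q - 1) c y"
proof -
  define t where "t = 2 * y / c - 1"
  have t: "-1 < t" "t < 1" and y: "y = c * ((1 + t) / 2)"
    using assms by (simp_all add: t_def field_simps)
  have hj: "hom_jacobi (int m) p' q' c y = c ^ m * jacobi m p' q' t" for m p' q'
    by (simp add: hom_jacobi_def t_def)
  have "(2 * real n + p + q + 1) * (y * (c ^ n * jacobi n p q t))
      = c ^ Suc n * ((2 * real n + p + q + 1) * ((1 + t) / 2) * jacobi n p q t)"
    by (subst y) (simp add: mult_ac)
  also have "\<dots> = (real n + q) * (c * (c ^ n * jacobi n p (q - 1) t))
      + (real n + 1) * (c ^ Suc n * jacobi (Suc n) p (q - 1) t)"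
    by (simp only: jacobi_lower_q[OF t] power_Suc) algebra
  finally show ?thesis
    using hj[of n p q] hj[of n p "q - 1"] hj[of "Suc n" p "q - 1"] by (simp add: add_ac)
qed

lemma hom_jacobi_lower_p:
  assumes "0 < y" "y < c"
  shows "(2 * real n + p + q + 1) * ((c - y) * hom_jacobi (int n) p q c y)
    = (real n + p) * (c * hom_jacobi (int n) (p - 1) q c y)
      - (real n + 1) * hom_jacobi (int n + 1) (p - 1) q c y"
proof -
  define t where "t = 2 * y / c - 1"
  have t: "-1 < t" "t < 1" and y: "c - y = c * ((1 - t) / 2)"
    using assms by (simp_all add: t_def field_simps)
  have hj: "hom_jacobi (int m) p' q' c y = c ^ m * jacobi m p' q' t" for m p' q'
    by (simp add: hom_jacobi_def t_def)
  have "(2 * real n + p + q + 1) * ((c - y) * (c ^ n * jacobi n p q t))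
      = c ^ Suc n * ((2 * real n + p + q + 1) * ((1 - t) / 2) * jacobi n p q t)"
    by (subst y) (simp add: mult_ac)
  also have "\<dots> = (real n + p) * (c * (c ^ n * jacobi n (p - 1) q t))
      - (real n + 1) * (c ^ Suc n * jacobi (Suc n) (p - 1) q t)"
    by (simp only: jacobi_lower_p[OF t] power_Suc) algebra
  finally show ?thesis
    using hj[of n p q] hj[of n "p - 1" q] hj[of "Suc n" "p - 1" q] by (simp add: add_ac)
qed

lemma hom_jacobi_raise_p:
  assumes "0 < y" "y < c"
  shows "(2 * real n + p + q + 1) * hom_jacobi (int n) p q c y
    = (real n + p + q + 1) * hom_jacobi (int n) (p + 1) q c y
      - (real n + q) * (c * hom_jacobi (int n - 1) (p + 1) q c y)"
proof (cases n)
  case 0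
  have "-1 < 2 * y / c - 1" "2 * y / c - 1 < 1"
    using assms by (simp_all add: field_simps)
  then have "jacobi 0 p' q (2 * y / c - 1) = 1" for p'
    by (rule jacobi_0)
  with 0 show ?thesis by (simp add: hom_jacobi_def)
next
  case (Suc m)
  define t where "t = 2 * y / c - 1"
  have t: "-1 < t" "t < 1"
    using assms by (simp_all add: t_def field_simps)
  have hj: "hom_jacobi (int m) p' q' c y = c ^ m * jacobi m p' q' t" for m p' q'
    by (simp add: hom_jacobi_def t_def)
  have "(2 * real n + p + q + 1) * (c ^ n * jacobi n p q t)
      = c ^ n * ((2 * real n + p + q + 1) * jacobi n p q t)"
    by (simp add: mult_ac)
  also have "\<dots> = (real n + p + q + 1) * (c ^ n * jacobi n (p + 1) q t)
      - (real n + q) * (c * (c ^ m * jacobi m (p + 1) q t))"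
    by (simp only: Suc jacobi_raise_p[OF t] power_Suc) algebra
  moreover have "int n - 1 = int m"
    by (simp add: Suc)
  ultimately show ?thesis
    by (simp only: hj)
qed

section \<open>Relations for Koornwinder polynomials\<close>

lemma koornwinder_eq_hom_jacobi:
  assumes "P = \<beta> + \<gamma> + \<delta> + 2 * of_int k2 + 2 * of_int k3 + 2" "R = \<gamma> + \<delta> + 2 * of_int k3 + 1"
  shows "koornwinder \<alpha> \<beta> \<gamma> \<delta> k1 k2 k3 (x, y, z)
    = hom_jacobi k1 P \<alpha> 1 x * hom_jacobi k2 R \<beta> (1 - x) y * hom_jacobi k3 \<delta> \<gamma> (1 - x - y) z"
  using assms by (simp add: koornwinder_def koornwinder_nat_def hom_jacobi_def)

theorem corollary8:
  fixes n1 n2 n3 n :: nat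
    and \<alpha> \<beta> \<gamma> \<delta> x y z w :: real
  assumes "n = n1 + n2 + n3"
    and "(x, y, z) \<in> simplex3"
    and "w = 1 - x - y - z"
  shows
    "((2 * real n + \<alpha> + \<beta> + \<gamma> + \<delta> + 3) * x * koornwinder \<alpha> \<beta> \<gamma> \<delta> (int n1) (int n2) (int n3) (x, y, z)
     = (real n1 + \<alpha>) * koornwinder (\<alpha> - 1) \<beta> \<gamma> \<delta> (int n1) (int n2) (int n3) (x, y, z)
       + (real n1 + 1) * koornwinder (\<alpha> - 1) \<beta> \<gamma> \<delta> (int n1 + 1) (int n2) (int n3) (x, y, z))
     \<and> ((2 * real n + \<alpha> + \<beta> + \<gamma> + \<delta> + 3) * (2 * real n2 + 2 * real n3 + \<beta> + \<gamma> + \<delta> + 2) * y * koornwinder \<alpha> \<beta> \<gamma> \<delta> (int n1) (int n2) (int n3) (x, y, z)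
     = (real n + real n2 + real n3 + \<beta> + \<gamma> + \<delta> + 2) * (real n2 + \<beta>) * koornwinder \<alpha> (\<beta> - 1) \<gamma> \<delta> (int n1) (int n2) (int n3) (x, y, z)
       + (real n + real n2 + real n3 + \<alpha> + \<beta> + \<gamma> + \<delta> + 3) * (real n2 + 1) * koornwinder \<alpha> (\<beta> - 1) \<gamma> \<delta> (int n1) (int n2 + 1) (int n3) (x, y, z)
       - (real n1 + 1) * (real n2 + \<beta>) * koornwinder \<alpha> (\<beta> - 1) \<gamma> \<delta> (int n1 + 1) (int n2) (int n3) (x, y, z)
       - (real n1 + \<alpha>) * (real n2 + 1) * koornwinder \<alpha> (\<beta> - 1) \<gamma> \<delta> (int n1 - 1) (int n2 + 1) (int n3) (x, y, z))
     \<and> ((2 * real n + \<alpha> + \<beta> + \<gamma> + \<delta> + 3) * (2 * real n2 + 2 * real n3 + \<beta> + \<gamma> + \<delta> + 2) * (\<gamma> + \<delta> + 2 * real n3 + 1) * z * koornwinder \<alpha> \<beta> \<gamma> \<delta> (int n1) (int n2) (int n3) (x, y, z)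
     = (real n + real n2 + real n3 + \<beta> + \<gamma> + \<delta> + 2) * (real n2 + 2 * real n3 + \<gamma> + \<delta> + 1) * (real n3 + \<gamma>) * koornwinder \<alpha> \<beta> (\<gamma> - 1) \<delta> (int n1) (int n2) (int n3) (x, y, z)
       - (real n1 + 1) * (real n2 + 2 * real n3 + \<gamma> + \<delta> + 1) * (real n3 + \<gamma>) * koornwinder \<alpha> \<beta> (\<gamma> - 1) \<delta> (int n1 + 1) (int n2) (int n3) (x, y, z)
       - (real n + real n2 + real n3 + \<alpha> + \<beta> + \<gamma> + \<delta> + 3) * (real n2 + 1) * (real n3 + \<gamma>) * koornwinder \<alpha> \<beta> (\<gamma> - 1) \<delta> (int n1) (int n2 + 1) (int n3) (x, y, z)
       + (real n1 + \<alpha>) * (real n2 + 1) * (real n3 + \<gamma>) * koornwinder \<alpha> \<beta> (\<gamma> - 1) \<delta> (int n1 - 1) (int n2 + 1) (int n3) (x, y, z)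
       + (real n + real n2 + real n3 + \<alpha> + \<beta> + \<gamma> + \<delta> + 3) * (real n2 + 2 * real n3 + \<beta> + \<gamma> + \<delta> + 2) * (real n3 + 1) * koornwinder \<alpha> \<beta> (\<gamma> - 1) \<delta> (int n1) (int n2) (int n3 + 1) (x, y, z)
       - (real n1 + \<alpha>) * (real n2 + 2 * real n3 + \<beta> + \<gamma> + \<delta> + 2) * (real n3 + 1) * koornwinder \<alpha> \<beta> (\<gamma> - 1) \<delta> (int n1 - 1) (int n2) (int n3 + 1) (x, y, z)
       - (real n + real n2 + real n3 + \<beta> + \<gamma> + \<delta> + 2) * (real n2 + \<beta>) * (real n3 + 1) * koornwinder \<alpha> \<beta> (\<gamma> - 1) \<delta> (int n1) (int n2 - 1) (int n3 + 1) (x, y, z)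
       + (real n1 + 1) * (real n2 + \<beta>) * (real n3 + 1) * koornwinder \<alpha> \<beta> (\<gamma> - 1) \<delta> (int n1 + 1) (int n2 - 1) (int n3 + 1) (x, y, z))
     \<and> ((2 * real n + \<alpha> + \<beta> + \<gamma> + \<delta> + 3) * (2 * real n2 + 2 * real n3 + \<beta> + \<gamma> + \<delta> + 2) * (\<gamma> + \<delta> + 2 * real n3 + 1) * w * koornwinder \<alpha> \<beta> \<gamma> \<delta> (int n1) (int n2) (int n3) (x, y, z)
     = - (real n + real n2 + real n3 + \<alpha> + \<beta> + \<gamma> + \<delta> + 3) * (real n2 + 2 * real n3 + \<beta> + \<gamma> + \<delta> + 2) * (real n3 + 1) * koornwinder \<alpha> \<beta> \<gamma> (\<delta> - 1) (int n1) (int n2) (int n3 + 1) (x, y, z)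
       + (real n1 + \<alpha>) * (real n2 + 2 * real n3 + \<beta> + \<gamma> + \<delta> + 2) * (real n3 + 1) * koornwinder \<alpha> \<beta> \<gamma> (\<delta> - 1) (int n1 - 1) (int n2) (int n3 + 1) (x, y, z)
       + (real n + real n2 + real n3 + \<beta> + \<gamma> + \<delta> + 2) * (real n2 + \<beta>) * (real n3 + 1) * koornwinder \<alpha> \<beta> \<gamma> (\<delta> - 1) (int n1) (int n2 - 1) (int n3 + 1) (x, y, z)
       - (real n1 + 1) * (real n2 + \<beta>) * (real n3 + 1) * koornwinder \<alpha> \<beta> \<gamma> (\<delta> - 1) (int n1 + 1) (int n2 - 1) (int n3 + 1) (x, y, z)
       + (real n + real n2 + real n3 + \<beta> + \<gamma> + \<delta> + 2) * (real n2 + 2 * real n3 + \<gamma> + \<delta> + 1) * (real n3 + \<delta>) * koornwinder \<alpha> \<beta> \<gamma> (\<delta> - 1) (int n1) (int n2) (int n3) (x, y, z)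
       - (real n1 + 1) * (real n2 + 2 * real n3 + \<gamma> + \<delta> + 1) * (real n3 + \<delta>) * koornwinder \<alpha> \<beta> \<gamma> (\<delta> - 1) (int n1 + 1) (int n2) (int n3) (x, y, z)
       - (real n + real n2 + real n3 + \<alpha> + \<beta> + \<gamma> + \<delta> + 3) * (real n2 + 1) * (real n3 + \<delta>) * koornwinder \<alpha> \<beta> \<gamma> (\<delta> - 1) (int n1) (int n2 + 1) (int n3) (x, y, z)
       + (real n1 + \<alpha>) * (real n2 + 1) * (real n3 + \<delta>) * koornwinder \<alpha> \<beta> \<gamma> (\<delta> - 1) (int n1 - 1) (int n2 + 1) (int n3) (x, y, z))"
proof -
  define P where "P = \<beta> + \<gamma> + \<delta> + 2 * real n2 + 2 * real n3 + 2"
  define R where "R = \<gamma> + \<delta> + 2 * real n3 + 1"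
  define c where "c = 1 - x"
  define d where "d = c - y"
  have x: "0 < x" "x < 1" and y: "0 < y" "y < c" and z: "0 < z" "z < d"
    using assms(2) by (auto simp: simplex3_def c_def d_def)
  have w: "w = d - z"
    using assms(3) by (simp add: c_def d_def)
  have P: "2 * real n2 + R + \<beta> + 1 = P"
    by (simp add: P_def R_def)
  define S where "S = 2 * real n1 + P + \<alpha> + 1"
  define T where "T = 2 * real n3 + \<delta> + \<gamma> + 1"
  have coeffs:
    "2 * real n + \<alpha> + \<beta> + \<gamma> + \<delta> + 3 = S"
    "2 * real n2 + 2 * real n3 + \<beta> + \<gamma> + \<delta> + 2 = P"
    "\<gamma> + \<delta> + 2 * real n3 + 1 = T"
    "real n + real n2 + real n3 + \<beta> + \<gamma> + \<delta> + 2 = real n1 + P"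
    "real n + real n2 + real n3 + \<alpha> + \<beta> + \<gamma> + \<delta> + 3 = real n1 + P + \<alpha> + 1"
    "real n2 + 2 * real n3 + \<gamma> + \<delta> + 1 = real n2 + R"
    "real n2 + 2 * real n3 + \<beta> + \<gamma> + \<delta> + 2 = real n2 + R + \<beta> + 1"
    using assms(1) by (simp_all add: S_def T_def P_def R_def)
  note K = koornwinder_eq_hom_jacobi[where x = x and y = y and z = z, folded c_def, folded d_def]
  have K0: "koornwinder \<alpha> \<beta> \<gamma> \<delta> (int n1) (int n2) (int n3) (x, y, z)
      = hom_jacobi (int n1) P \<alpha> 1 x * hom_jacobi (int n2) R \<beta> c y * hom_jacobi (int n3) \<delta> \<gamma> d z"
    by (rule K) (simp_all add: P_def R_def)

  note first = hom_jacobi_lower_q[OF x, of n1 P \<alpha>, folded S_def]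
    hom_jacobi_lower_p[OF x, of n1 P \<alpha>, folded S_def c_def]
    hom_jacobi_raise_p[OF x, of n1 P \<alpha>, folded S_def]
  note second = hom_jacobi_lower_q[OF y, of n2 R \<beta>, unfolded P]
    hom_jacobi_lower_p[OF y, of n2 R \<beta>, unfolded P, folded d_def]
    hom_jacobi_raise_p[OF y, of n2 R \<beta>, unfolded P]
  note third = hom_jacobi_lower_q[OF z, of n3 \<delta> \<gamma>, folded T_def]
    hom_jacobi_lower_p[OF z, of n3 \<delta> \<gamma>, folded T_def w]

  have K1:
    "koornwinder (\<alpha> - 1) \<beta> \<gamma> \<delta> (int n1) (int n2) (int n3) (x, y, z)
      = hom_jacobi (int n1) P (\<alpha> - 1) 1 x * hom_jacobi (int n2) R \<beta> c y * hom_jacobi (int n3) \<delta> \<gamma> d z"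
    "koornwinder (\<alpha> - 1) \<beta> \<gamma> \<delta> (int n1 + 1) (int n2) (int n3) (x, y, z)
      = hom_jacobi (int n1 + 1) P (\<alpha> - 1) 1 x * hom_jacobi (int n2) R \<beta> c y * hom_jacobi (int n3) \<delta> \<gamma> d z"
    by (rule K; simp add: P_def R_def)+
  \<comment> \<open>Degrees enter \<open>P\<close> and \<open>R\<close> twice and parameters once: raising \<open>n2\<close> while lowering \<open>\<beta>\<close>, for
    instance, adds one to \<open>P\<close>.\<close>
  have K2:
    "koornwinder \<alpha> (\<beta> - 1) \<gamma> \<delta> (int n1) (int n2) (int n3) (x, y, z)
      = hom_jacobi (int n1) (P - 1) \<alpha> 1 x * hom_jacobi (int n2) R (\<beta> - 1) c y * hom_jacobi (int n3) \<delta> \<gamma> d z"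
    "koornwinder \<alpha> (\<beta> - 1) \<gamma> \<delta> (int n1) (int n2 + 1) (int n3) (x, y, z)
      = hom_jacobi (int n1) (P + 1) \<alpha> 1 x * hom_jacobi (int n2 + 1) R (\<beta> - 1) c y * hom_jacobi (int n3) \<delta> \<gamma> d z"
    "koornwinder \<alpha> (\<beta> - 1) \<gamma> \<delta> (int n1 + 1) (int n2) (int n3) (x, y, z)
      = hom_jacobi (int n1 + 1) (P - 1) \<alpha> 1 x * hom_jacobi (int n2) R (\<beta> - 1) c y * hom_jacobi (int n3) \<delta> \<gamma> d z"
    "koornwinder \<alpha> (\<beta> - 1) \<gamma> \<delta> (int n1 - 1) (int n2 + 1) (int n3) (x, y, z)
      = hom_jacobi (int n1 - 1) (P + 1) \<alpha> 1 x * hom_jacobi (int n2 + 1) R (\<beta> - 1) c y * hom_jacobi (int n3) \<delta> \<gamma> d z"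
    by (rule K; simp add: P_def R_def)+
  have K3:
    "koornwinder \<alpha> \<beta> (\<gamma> - 1) \<delta> (int n1) (int n2) (int n3) (x, y, z)
      = hom_jacobi (int n1) (P - 1) \<alpha> 1 x * hom_jacobi (int n2) (R - 1) \<beta> c y * hom_jacobi (int n3) \<delta> (\<gamma> - 1) d z"
    "koornwinder \<alpha> \<beta> (\<gamma> - 1) \<delta> (int n1 + 1) (int n2) (int n3) (x, y, z)
      = hom_jacobi (int n1 + 1) (P - 1) \<alpha> 1 x * hom_jacobi (int n2) (R - 1) \<beta> c y * hom_jacobi (int n3) \<delta> (\<gamma> - 1) d z"
    "koornwinder \<alpha> \<beta> (\<gamma> - 1) \<delta> (int n1) (int n2 + 1) (int n3) (x, y, z)
      = hom_jacobi (int n1) (P + 1) \<alpha> 1 x * hom_jacobi (int n2 + 1) (R - 1) \<beta> c y * hom_jacobi (int n3) \<delta> (\<gamma> - 1) d z"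
    "koornwinder \<alpha> \<beta> (\<gamma> - 1) \<delta> (int n1 - 1) (int n2 + 1) (int n3) (x, y, z)
      = hom_jacobi (int n1 - 1) (P + 1) \<alpha> 1 x * hom_jacobi (int n2 + 1) (R - 1) \<beta> c y * hom_jacobi (int n3) \<delta> (\<gamma> - 1) d z"
    "koornwinder \<alpha> \<beta> (\<gamma> - 1) \<delta> (int n1) (int n2) (int n3 + 1) (x, y, z)
      = hom_jacobi (int n1) (P + 1) \<alpha> 1 x * hom_jacobi (int n2) (R + 1) \<beta> c y * hom_jacobi (int n3 + 1) \<delta> (\<gamma> - 1) d z"
    "koornwinder \<alpha> \<beta> (\<gamma> - 1) \<delta> (int n1 - 1) (int n2) (int n3 + 1) (x, y, z)
      = hom_jacobi (int n1 - 1) (P + 1) \<alpha> 1 x * hom_jacobi (int n2) (R + 1) \<beta> c y * hom_jacobi (int n3 + 1) \<delta> (\<gamma> - 1) d z"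
    "koornwinder \<alpha> \<beta> (\<gamma> - 1) \<delta> (int n1) (int n2 - 1) (int n3 + 1) (x, y, z)
      = hom_jacobi (int n1) (P - 1) \<alpha> 1 x * hom_jacobi (int n2 - 1) (R + 1) \<beta> c y * hom_jacobi (int n3 + 1) \<delta> (\<gamma> - 1) d z"
    "koornwinder \<alpha> \<beta> (\<gamma> - 1) \<delta> (int n1 + 1) (int n2 - 1) (int n3 + 1) (x, y, z)
      = hom_jacobi (int n1 + 1) (P - 1) \<alpha> 1 x * hom_jacobi (int n2 - 1) (R + 1) \<beta> c y * hom_jacobi (int n3 + 1) \<delta> (\<gamma> - 1) d z"
    by (rule K; simp add: P_def R_def)+
  have K4:
    "koornwinder \<alpha> \<beta> \<gamma> (\<delta> - 1) (int n1) (int n2) (int n3) (x, y, z)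
      = hom_jacobi (int n1) (P - 1) \<alpha> 1 x * hom_jacobi (int n2) (R - 1) \<beta> c y * hom_jacobi (int n3) (\<delta> - 1) \<gamma> d z"
    "koornwinder \<alpha> \<beta> \<gamma> (\<delta> - 1) (int n1 + 1) (int n2) (int n3) (x, y, z)
      = hom_jacobi (int n1 + 1) (P - 1) \<alpha> 1 x * hom_jacobi (int n2) (R - 1) \<beta> c y * hom_jacobi (int n3) (\<delta> - 1) \<gamma> d z"
    "koornwinder \<alpha> \<beta> \<gamma> (\<delta> - 1) (int n1) (int n2 + 1) (int n3) (x, y, z)
      = hom_jacobi (int n1) (P + 1) \<alpha> 1 x * hom_jacobi (int n2 + 1) (R - 1) \<beta> c y * hom_jacobi (int n3) (\<delta> - 1) \<gamma> d z"
    "koornwinder \<alpha> \<beta> \<gamma> (\<delta> - 1) (int n1 - 1) (int n2 + 1) (int n3) (x, y, z)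
      = hom_jacobi (int n1 - 1) (P + 1) \<alpha> 1 x * hom_jacobi (int n2 + 1) (R - 1) \<beta> c y * hom_jacobi (int n3) (\<delta> - 1) \<gamma> d z"
    "koornwinder \<alpha> \<beta> \<gamma> (\<delta> - 1) (int n1) (int n2) (int n3 + 1) (x, y, z)
      = hom_jacobi (int n1) (P + 1) \<alpha> 1 x * hom_jacobi (int n2) (R + 1) \<beta> c y * hom_jacobi (int n3 + 1) (\<delta> - 1) \<gamma> d z"
    "koornwinder \<alpha> \<beta> \<gamma> (\<delta> - 1) (int n1 - 1) (int n2) (int n3 + 1) (x, y, z)
      = hom_jacobi (int n1 - 1) (P + 1) \<alpha> 1 x * hom_jacobi (int n2) (R + 1) \<beta> c y * hom_jacobi (int n3 + 1) (\<delta> - 1) \<gamma> d z"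
    "koornwinder \<alpha> \<beta> \<gamma> (\<delta> - 1) (int n1) (int n2 - 1) (int n3 + 1) (x, y, z)
      = hom_jacobi (int n1) (P - 1) \<alpha> 1 x * hom_jacobi (int n2 - 1) (R + 1) \<beta> c y * hom_jacobi (int n3 + 1) (\<delta> - 1) \<gamma> d z"
    "koornwinder \<alpha> \<beta> \<gamma> (\<delta> - 1) (int n1 + 1) (int n2 - 1) (int n3 + 1) (x, y, z)
      = hom_jacobi (int n1 + 1) (P - 1) \<alpha> 1 x * hom_jacobi (int n2 - 1) (R + 1) \<beta> c y * hom_jacobi (int n3 + 1) (\<delta> - 1) \<gamma> d z"
    by (rule K; simp add: P_def R_def)+
  \<comment> \<open>Each relation is now the product of the left-hand sides for the three factors, expanded by
    their right-hand sides from the last factor to the first.\<close>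
  show ?thesis
    unfolding coeffs K0 K1 K2 K3 K4
    apply (intro conjI)
    subgoal using first(1) by algebra
    subgoal using first(2,3) second(1) by algebra
    subgoal using first(2,3) second(2,3) third(1) by algebra
    subgoal using first(2,3) second(2,3) third(2) by algebra
    done
qed

end
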